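(* Let $P$ be a finite poset and let $L$ be a maximum antichain of $P$ (an antichain of largest cardinality) with $|L|=d$. Then $$\mathcal N_P(x)=\sum_{B\in\operatorname{Ant}(P\setminus L)}x^{|B|}(1+x)^{d-|\Gamma_L(B)|}.$$ Moreover, for every integer $0\le j\le d$, $$[x^{d-j}]\mathcal N_P(x)=\sum_{B\in\operatorname{Ant}(P\setminus L)}\binom{d-|\Gamma_L(B)|}{j-\delta_L(B)},$$ where $\binom ab=0$ whenever $b<0$ or $b>a$.
   Context: For a finite poset $Q$, $\operatorname{Ant}(Q)$ is the set of antichains of $Q$ (sets of pairwise incomparable elements, including the empty set), and the antichain polynomial is $\mathcal N_Q(x)=\sum_{\mathcal A\in\operatorname{Ant}(Q)}x^{|\mathcal A|}$. $[x^i]f$ denotes the coefficient of $x^i$ in $f$. For $B\in\operatorname{Ant}(P\setminus L)$, define $\Gamma_L(B)=\{z\in L: z\text{ is comparable with some } b\in B\}$ and $\delta_L(B)=|\Gamma_L(B)|-|B|$ (the $L$-defect of $B$). *)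

theory Defs
  imports "HOL-Computational_Algebra.Polynomial"
begin

text \<open>
  A finite poset is a finite set \<open>P\<close> with an order relation \<open>r\<close>, \<open>partial_order_on P r\<close>.
  The notions below take the relation and a subset \<open>Q\<close> of \<open>P\<close>; since they only compare elements
  of \<open>Q\<close>, they refer to the subposet \<open>Q\<close> with the induced order.
\<close>

definition comparable :: "'a rel \<Rightarrow> 'a \<Rightarrow> 'a \<Rightarrow> bool" where
  "comparable r x y \<longleftrightarrow> (x, y) \<in> r \<or> (y, x) \<in> r"

definition antichains :: "'a rel \<Rightarrow> 'a set \<Rightarrow> 'a set set" where
  "antichains r Q = {A. A \<subseteq> Q \<and> pairwise (\<lambda>x y. \<not> comparable r x y) A}"

definition maximum_antichain :: "'a rel \<Rightarrow> 'a set \<Rightarrow> 'a set \<Rightarrow> bool" where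
  "maximum_antichain r Q L \<longleftrightarrow>
     L \<in> antichains r Q \<and> (\<forall>A \<in> antichains r Q. card A \<le> card L)"

definition antichain_poly :: "'a rel \<Rightarrow> 'a set \<Rightarrow> int poly" where
  "antichain_poly r Q = (\<Sum>A \<in> antichains r Q. monom 1 (card A))"

definition Gamma :: "'a rel \<Rightarrow> 'a set \<Rightarrow> 'a set \<Rightarrow> 'a set" where
  "Gamma r L B = {z \<in> L. \<exists>b \<in> B. comparable r z b}"

text \<open>The defect can a priori be negative, hence the subtraction takes place in the integers.\<close>

definition defect :: "'a rel \<Rightarrow> 'a set \<Rightarrow> 'a set \<Rightarrow> int" where
  "defect r L B = int (card (Gamma r L B)) - int (card B)"

text \<open>
  Binomial coefficient with integer arguments, zero unless \<open>0 \<le> b \<le> a\<close>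
  (in particular zero for negative \<open>a\<close>).
\<close>

definition int_binomial :: "int \<Rightarrow> int \<Rightarrow> int" where
  "int_binomial a b = (if b < 0 \<or> b > a then 0 else int (nat a choose nat b))"

text \<open>
  \<open>Gamma r L B\<close> is a subset of \<open>L\<close>, so natural-number differences of the form
  \<open>card L - card (Gamma r L B)\<close> do not truncate.
\<close>

lemma card_Gamma_le: "finite L \<Longrightarrow> card (Gamma r L B) \<le> card L"
  by (rule card_mono) (auto simp: Gamma_def)

end

theory Submission
  imports Defs
begin

text \<open>
  An antichain splits uniquely into its part \<open>B\<close> outside \<open>L\<close> and a part inside \<open>L\<close>. As \<open>L\<close> is
  itself an antichain, the latter may be any subset of \<open>L - Gamma r L B\<close>; summing \<open>x ^ card C\<close>
  over these subsets \<open>C\<close> gives a power of \<open>1 + x\<close>.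
\<close>

text \<open>Expand the product of \<open>card S\<close> factors \<open>x + 1\<close>: the subset
  \<open>C\<close> records the factors that contribute \<open>x\<close>, all others contribute
  1.\<close>

lemma sum_Pow_monom_card:
  assumes "finite S"
  shows "(\<Sum>C \<in> Pow S. monom 1 (card C)) = ([:1, 1:] :: 'b::comm_ring_1 poly) ^ card S"
proof -
  have "([:1, 1:] :: 'b poly) ^ card S = (\<Prod>a \<in> S. [:0, 1:] + 1)"
    by (simp add: one_pCons)
  also have "\<dots> = (\<Sum>C \<in> Pow S. monom 1 (card C))"
    using assms by (subst prod_add) (simp_all add: monom_altdef)
  finally show ?thesis ..
qed

lemma finite_antichain: "finite Q \<Longrightarrow> A \<in> antichains r Q \<Longrightarrow> finite A"
  unfolding antichains_def using finite_subset by blast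

lemma finite_antichains: "finite Q \<Longrightarrow> finite (antichains r Q)"
  unfolding antichains_def by (rule finite_subset[of _ "Pow Q"]) auto

lemma bij_betw_antichains_split:
  assumes L: "L \<in> antichains r P"
  shows "bij_betw (\<lambda>(B, C). B \<union> C)
    (SIGMA B : antichains r (P - L). Pow (L - Gamma r L B)) (antichains r P)"
proof (rule bij_betw_byWitness[where f' = "\<lambda>A. (A - L, A \<inter> L)"])
  show "(\<lambda>(B, C). B \<union> C) ` (SIGMA B : antichains r (P - L). Pow (L - Gamma r L B))
      \<subseteq> antichains r P"
  proof clarsimp
    fix B C assume B: "B \<in> antichains r (P - L)" and C: "C \<subseteq> L - Gamma r L B"
    \<comment> \<open>\<open>pairwise\<close> ranges over ordered pairs, so cross pairs between
      \<open>B\<close> and \<open>C\<close> are needed in both orders.\<close>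
    have "\<not> comparable r x y \<and> \<not> comparable r y x" if "x \<in> B" "y \<in> C" for x y
      using that C unfolding Gamma_def comparable_def by blast
    then show "B \<union> C \<in> antichains r P"
      using L B C unfolding antichains_def pairwise_def by blast
  qed
  show "(\<lambda>A. (A - L, A \<inter> L)) ` antichains r P
      \<subseteq> (SIGMA B : antichains r (P - L). Pow (L - Gamma r L B))"
  proof (rule image_subsetI)
    fix A assume A: "A \<in> antichains r P"
    then have pw: "pairwise (\<lambda>x y. \<not> comparable r x y) A" and "A \<subseteq> P"
      by (simp_all add: antichains_def)
    have "\<not> comparable r z b" if "z \<in> A \<inter> L" "b \<in> A - L" for z b
      by (rule pairwiseD[OF pw]) (use that in auto)
    then have "A \<inter> L \<in> Pow (L - Gamma r L (A - L))"
      unfolding Gamma_def by blast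
    moreover have "A - L \<in> antichains r (P - L)"
      using pairwise_subset[OF pw, of "A - L"] \<open>A \<subseteq> P\<close> by (auto simp: antichains_def)
    ultimately show "(A - L, A \<inter> L) \<in> (SIGMA B : antichains r (P - L). Pow (L - Gamma r L B))"
      by (rule SigmaI[rotated])
  qed
\<comment> \<open>What remains is that the two maps are mutually inverse: \<open>B\<close> avoids
  \<open>L\<close> and \<open>C\<close> lies in \<open>L\<close>, so cutting the union along
  \<open>L\<close> returns the pair.\<close>
qed (auto simp: antichains_def)

lemma antichain_poly_split:
  assumes "finite P" and L: "L \<in> antichains r P"
  shows "antichain_poly r P =
    (\<Sum>B \<in> antichains r (P - L). monom 1 (card B) * [:1, 1:] ^ (card L - card (Gamma r L B)))"
proof -
  have finL: "finite L"
    using assms finite_antichain by blast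
  have "antichain_poly r P =
      (\<Sum>(B, C) \<in> (SIGMA B : antichains r (P - L). Pow (L - Gamma r L B)). monom 1 (card (B \<union> C)))"
    unfolding antichain_poly_def sum.reindex_bij_betw[OF bij_betw_antichains_split[OF L], symmetric]
    by (simp add: case_prod_unfold)
  also have "\<dots> = (\<Sum>B \<in> antichains r (P - L). \<Sum>C \<in> Pow (L - Gamma r L B). monom 1 (card (B \<union> C)))"
    using assms(1) finL by (intro sum.Sigma[symmetric]) (auto simp: finite_antichains)
  also have "\<dots> = (\<Sum>B \<in> antichains r (P - L).
      monom 1 (card B) * [:1, 1:] ^ (card L - card (Gamma r L B)))"
  proof (rule sum.cong)
    fix B assume "B \<in> antichains r (P - L)"
    then have B: "finite B" "B \<inter> L = {}"
      using assms(1) finite_antichain[of "P - L" B] by (auto simp: antichains_def)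
    have "(\<Sum>C \<in> Pow (L - Gamma r L B). monom (1::int) (card (B \<union> C))) =
        (\<Sum>C \<in> Pow (L - Gamma r L B). monom 1 (card B) * monom 1 (card C))"
    proof (rule sum.cong)
      fix C assume "C \<in> Pow (L - Gamma r L B)"
      then have "finite C" "B \<inter> C = {}"
        using B finL finite_subset[of C L] by auto
      then have "card (B \<union> C) = card B + card C"
        using B by (intro card_Un_disjoint)
      then show "monom (1::int) (card (B \<union> C)) = monom 1 (card B) * monom 1 (card C)"
        by (simp add: mult_monom)
    qed simp
    also have "\<dots> = monom 1 (card B) * [:1, 1:] ^ card (L - Gamma r L B)"
      using finL by (simp add: sum_distrib_left[symmetric] sum_Pow_monom_card)
    also have "card (L - Gamma r L B) = card L - card (Gamma r L B)"
      using finL by (intro card_Diff_subset) (auto simp: Gamma_def)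
    finally show "(\<Sum>C \<in> Pow (L - Gamma r L B). monom (1::int) (card (B \<union> C))) =
        monom 1 (card B) * [:1, 1:] ^ (card L - card (Gamma r L B))" .
  qed simp
  finally show ?thesis .
qed

text \<open>Removing the factor \<open>x ^ b\<close> leaves the coefficient of (1 + x)^(d - g) at d
  - j - b. Symmetry of binomials replaces this lower index by (d - g) - (d - j - b) = j - (g - b),
  the form with the defect. The cases match the ranges where \<open>int_binomial\<close> is zero by
  convention.\<close>

lemma coeff_monom_mult_linear_power:
  assumes "j \<le> d" "g \<le> d"
  shows "coeff (monom (1::int) b * [:1, 1:] ^ (d - g)) (d - j) =
    int_binomial (int d - int g) (int j - (int g - int b))"
proof -
  consider "d - j < b" | "b \<le> d - j" "d - g < d - j - b" | "b \<le> d - j" "d - j - b \<le> d - g"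
    by linarith
  then show ?thesis
  proof cases
    \<comment> \<open>The exponent is too small for the factor \<open>x ^ b\<close>; on the right
      the lower index exceeds the upper one.\<close>
    case 1
    moreover from this have "int j - (int g - int b) > int d - int g"
      using assms by linarith
    ultimately show ?thesis
      by (simp only: coeff_monom_mult int_binomial_def) simp
  next
    \<comment> \<open>The exponent exceeds the degree b + (d - g) of the product; on the right the
      lower index is negative.\<close>
    case 2
    then have "coeff ([:1, 1:] ^ (d - g)) (d - j - b) = (0::int)"
      by (intro coeff_eq_0) (simp add: degree_linear_power)
    moreover have "int j - (int g - int b) < 0"
      using assms 2 by linarith
    ultimately show ?thesis
      using 2(1) by (simp only: coeff_monom_mult int_binomial_def) simp
  next
    case 3
    \<comment> \<open>In this range no natural-number subtraction truncates, so both arguments of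
      \<open>int_binomial\<close> are images of naturals.\<close>
    have "int d - int g = int (d - g)"
      "int j - (int g - int b) = int (d - g - (d - j - b))"
      using assms 3 by linarith+
    then have "int_binomial (int d - int g) (int j - (int g - int b)) =
        int (d - g choose (d - g - (d - j - b)))"
      by (simp add: int_binomial_def del: of_nat_diff)
    then show ?thesis
      using 3 binomial_symmetric[OF 3(2)] by (simp add: coeff_monom_mult coeff_linear_poly_power)
  qed
qed

theorem theorem2p1:
  fixes P L :: "'a set" and r :: "'a rel" and d :: nat
  assumes "finite P"
    and "partial_order_on P r"
    and "maximum_antichain r P L"
    and "card L = d"
  shows "antichain_poly r P =
           (\<Sum>B \<in> antichains r (P - L). monom 1 (card B) * [:1, 1:] ^ (d - card (Gamma r L B)))
       \<and> (\<forall>j::nat. j \<le> d \<longrightarrow>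
           coeff (antichain_poly r P) (d - j) =
             (\<Sum>B \<in> antichains r (P - L).
                int_binomial (int d - int (card (Gamma r L B))) (int j - defect r L B)))"
proof -
  have L: "L \<in> antichains r P"
    using assms(3) by (simp add: maximum_antichain_def)
  have Gamma_le: "card (Gamma r L B) \<le> d" for B
    using card_Gamma_le[OF finite_antichain[OF assms(1) L]] assms(4) by simp
  note split = antichain_poly_split[OF assms(1) L, unfolded assms(4)]
  moreover have "coeff (antichain_poly r P) (d - j) =
      (\<Sum>B \<in> antichains r (P - L).
        int_binomial (int d - int (card (Gamma r L B))) (int j - defect r L B))"
    if "j \<le> d" for j
    \<comment> \<open>Coefficients are taken term by term, with
      \<open>g = card (Gamma r L B)\<close> and \<open>b = card B\<close>.\<close>
    unfolding split coeff_sum defect_def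
    by (intro sum.cong refl coeff_monom_mult_linear_power that Gamma_le)
  ultimately show ?thesis by blast
qed

end
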